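(* Let $1\le p<\infty$, $\beta>-n$, $\lambda=(\lambda_1,\lambda_2)\in\mathbb{R}^2$, and $-\lambda_2 \beta/n< \lambda_1 + \lambda_2 \le n$. If the Hardy–Littlewood maximal operator $M$ is bounded from $\mathcal L^{p,\lambda}(|x|^\beta)$ to $W\mathcal L^{p,\lambda}(|x|^\beta)$, then $$\lambda_1+\lambda_2 -n \le \beta \left(1-\frac {\lambda_2} n\right)<\lambda_1+\lambda_2 + n(p-1).$$
   Context: For a weight $w$ on $\mathbb{R}^n$, $w(E)=\int_E w$; $|E|$ is Lebesgue measure, $B(x,r)$ is the Euclidean ball. For $0<p<\infty$ and $\lambda=(\lambda_1,\lambda_2)$, $\mathcal L^{p,\lambda}(w)$ and $W\mathcal L^{p,\lambda}(w)$ are the spaces of measurable $f$ for which, respectively, $$\|f\|_{\mathcal L^{p,\lambda}(w)} := \sup_{x\in \mathbb{R}^n,\, r>0}\left(\frac 1{r^{\lambda_1}\, w(B(x,r))^{\lambda_2/n}}\int_{B(x,r)}|f|^p w\right)^{1/p}<\infty,$$ $$\|f\|_{W\mathcal L^{p,\lambda}(w)}:=\sup_{x\in \mathbb{R}^n,\, r>0,\, t>0}\left(\frac {t^p\,w(\{y\in B(x,r): |f(y)|>t\})}{|B(x,r)|^{\lambda_1/n}\, w(B(x,r))^{\lambda_2/n}}\right)^{1/p}<\infty.$$ $|x|^\beta$ denotes the power weight $x\mapsto|x|^\beta$. $Mf(x)=\sup_{B\ni x}\frac1{|B|}\int_B|f|$ over balls $B$ containing $x$. Boundedness means a norm inequality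 with constant independent of $f$. *)

theory Defs
  imports "HOL-Analysis.Analysis"
begin

text \<open>The role of \<open>\<real>\<^sup>n\<close> is played by a Euclidean space \<open>'a\<close> with \<open>n = DIM('a)\<close>.
  All suprema, integrals and quasi-norms take values in \<open>[0, \<infinity>]\<close>.\<close>

text \<open>Real powers on \<open>[0, \<infinity>]\<close> with the usual conventions. For \<open>x = 0\<close> this differs from
  \<^const>\<open>powr\<close>, where \<open>0 powr a = 0\<close> for every \<open>a\<close>.\<close>

definition ennpowr :: "ennreal \<Rightarrow> real \<Rightarrow> ennreal" (infixr "ennpowr" 80) where
  "x ennpowr a =
     (if a = 0 then 1
      else if x = 0 then (if a > 0 then 0 else \<infinity>)
      else if x = \<infinity> then (if a > 0 then \<infinity> else 0)
      else ennreal (enn2real x powr a))"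

definition weighted :: "('a::euclidean_space \<Rightarrow> real) \<Rightarrow> 'a set \<Rightarrow> ennreal" where
  "weighted w E = (\<integral>\<^sup>+ y \<in> E. ennreal (w y) \<partial>lebesgue)"

text \<open>At the origin this is \<open>0\<close> for every \<open>\<beta>\<close>; a single point is Lebesgue null, so the value there
  is irrelevant.\<close>

definition power_weight :: "real \<Rightarrow> 'a::euclidean_space \<Rightarrow> real" where
  "power_weight \<beta> x = norm x powr \<beta>"

definition morrey_norm ::
    "real \<Rightarrow> real \<Rightarrow> real \<Rightarrow> ('a::euclidean_space \<Rightarrow> real) \<Rightarrow> ('a \<Rightarrow> real) \<Rightarrow> ennreal" where
  "morrey_norm p l\<^sub>1 l\<^sub>2 w f =
     (SUP x. SUP r \<in> {0<..}.
        ((\<integral>\<^sup>+ y \<in> ball x r. ennreal (\<bar>f y\<bar> powr p * w y) \<partial>lebesgue)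
          / (ennreal (r powr l\<^sub>1) * weighted w (ball x r) ennpowr (l\<^sub>2 / real DIM('a))))
        ennpowr (1 / p))"

definition morrey_space ::
    "real \<Rightarrow> real \<Rightarrow> real \<Rightarrow> ('a::euclidean_space \<Rightarrow> real) \<Rightarrow> ('a \<Rightarrow> real) set" where
  "morrey_space p l\<^sub>1 l\<^sub>2 w =
     {f. f \<in> borel_measurable lebesgue \<and> morrey_norm p l\<^sub>1 l\<^sub>2 w f < \<infinity>}"

text \<open>The weak space only sees the modulus of a function, and the maximal function can be infinite;
  hence the argument \<open>g\<close> below is \<open>[0, \<infinity>]\<close>-valued and stands for \<open>\<bar>f\<bar>\<close>.\<close>

definition weak_morrey_norm ::
    "real \<Rightarrow> real \<Rightarrow> real \<Rightarrow> ('a::euclidean_space \<Rightarrow> real) \<Rightarrow> ('a \<Rightarrow> ennreal) \<Rightarrow> ennreal" where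
  "weak_morrey_norm p l\<^sub>1 l\<^sub>2 w g =
     (SUP x. SUP r \<in> {0<..}. SUP t \<in> {0<..}.
        ((ennreal (t powr p) * weighted w {y \<in> ball x r. g y > ennreal t})
          / (emeasure lebesgue (ball x r) ennpowr (l\<^sub>1 / real DIM('a))
             * weighted w (ball x r) ennpowr (l\<^sub>2 / real DIM('a))))
        ennpowr (1 / p))"

definition weak_morrey_space ::
    "real \<Rightarrow> real \<Rightarrow> real \<Rightarrow> ('a::euclidean_space \<Rightarrow> real) \<Rightarrow> ('a \<Rightarrow> ennreal) set" where
  "weak_morrey_space p l\<^sub>1 l\<^sub>2 w =
     {g. g \<in> borel_measurable lebesgue \<and> weak_morrey_norm p l\<^sub>1 l\<^sub>2 w g < \<infinity>}"

definition maximal :: "('a::euclidean_space \<Rightarrow> real) \<Rightarrow> 'a \<Rightarrow> ennreal" where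
  "maximal f x =
     (SUP (c, r) \<in> {(c, r). r > 0 \<and> x \<in> ball c r}.
        (\<integral>\<^sup>+ y \<in> ball c r. ennreal \<bar>f y\<bar> \<partial>lebesgue) / emeasure lebesgue (ball c r))"

definition maximal_bounded_weak ::
    "real \<Rightarrow> real \<Rightarrow> real \<Rightarrow> ('a::euclidean_space \<Rightarrow> real) \<Rightarrow> bool" where
  "maximal_bounded_weak p l\<^sub>1 l\<^sub>2 w \<longleftrightarrow>
     (\<exists>C::real. C \<ge> 0 \<and>
        (\<forall>f \<in> morrey_space p l\<^sub>1 l\<^sub>2 w.
           maximal f \<in> weak_morrey_space p l\<^sub>1 l\<^sub>2 w \<and>
           weak_morrey_norm p l\<^sub>1 l\<^sub>2 w (maximal f) \<le> ennreal C * morrey_norm p l\<^sub>1 l\<^sub>2 w f))"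

end

theory Submission
  imports Defs
begin

text \<open>
  Both inequalities come from testing the operator on \<open>f\<^sub>s(y) = \<bar>y\<bar>\<^sup>s\<close> restricted to the unit ball.
  Put \<open>\<gamma> = l\<^sub>1 + l\<^sub>2 + l\<^sub>2 \<beta> / n > 0\<close>. Since the \<open>\<bar>y\<bar>\<^sup>\<alpha>\<close>-measure of \<open>B(x, r)\<close> is comparable to
  \<open>r\<^sup>n (\<bar>x\<bar> + r)\<^sup>\<alpha>\<close> for every \<open>\<alpha> > -n\<close>, the function \<open>f\<^sub>s\<close> lies in the Morrey space as soon as
  \<open>n + \<beta> + p s \<ge> \<gamma>\<close>. On the unit ball \<open>M f\<^sub>s\<close> is at least the average of \<open>f\<^sub>s\<close> there, and if
  \<open>g > t\<close> on \<open>B(0, r)\<close> then the weak norm of \<open>g\<close> is at least a constant times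
  \<open>t (r powr ((n + \<beta> - \<gamma>) / p))\<close>. If \<open>\<beta> < \<gamma> - n\<close>, a large \<open>s\<close> and \<open>r \<rightarrow> 0\<close> give a
  contradiction. If \<open>\<beta> \<ge> \<gamma> + n (p - 1)\<close>, then \<open>s = -n\<close> is admissible, the average is infinite,
  and \<open>t \<rightarrow> \<infinity>\<close> with \<open>r = 1\<close> gives a contradiction.
\<close>

section \<open>Comparison of real powers and elementary facts on \<open>ennpowr\<close> and
  \<open>weighted\<close>\<close>

text \<open>The hypothesis is symmetric: it also gives \<open>X \<le> K * y\<close>. Monotonicity of
  the power for \<open>a \<ge> 0\<close> and antitonicity for \<open>a < 0\<close> then yield both
  bounds, and \<open>\<bar>a\<bar>\<close> lets one constant serve either sign.\<close>

lemma powr_comparable: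
  fixes X y K a :: real
  assumes "1 \<le> K" "0 < X" "X / K \<le> y" "y \<le> K * X"
  shows "X powr a / K powr \<bar>a\<bar> \<le> y powr a \<and> y powr a \<le> K powr \<bar>a\<bar> * X powr a"
proof -
  have y: "0 < y"
    using assms by (smt (verit) divide_pos_pos)
  have "X \<le> K * y"
    using assms by (simp add: field_simps)
  show ?thesis
  proof (cases "0 \<le> a")
    case True
    have "X powr a \<le> (K * y) powr a" "y powr a \<le> (K * X) powr a"
      using True \<open>X \<le> K * y\<close> assms y by (auto intro!: powr_mono2)
    then show ?thesis
      using True assms y by (simp add: powr_mult field_simps)
  next
    case False
    have "(K * X) powr a \<le> y powr a" "(K * y) powr a \<le> X powr a"
      using False \<open>X \<le> K * y\<close> assms y by (auto intro!: powr_mono2')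
    then show ?thesis
      using False assms y by (simp add: powr_mult powr_minus field_simps)
  qed
qed

lemma ennreal_ennpowr: "0 < x \<Longrightarrow> ennreal x ennpowr a = ennreal (x powr a)"
  by (auto simp: ennpowr_def)

lemma ennpowr_le:
  assumes "x \<le> ennreal B" "0 \<le> B" "0 < a"
  shows "x ennpowr a \<le> ennreal (B powr a)"
proof (cases "x = 0")
  case False
  obtain y where y: "x = ennreal y" "0 \<le> y"
    using assms by (cases x) (auto simp: top_unique)
  with False assms have "0 < y" "y \<le> B"
    by (auto simp: less_le)
  then show ?thesis
    using assms by (simp add: y ennreal_ennpowr powr_mono2)
qed (use assms in \<open>simp add: ennpowr_def\<close>)

lemma borel_measurable_power_weight [measurable]:
  "power_weight \<alpha> \<in> borel_measurable borel"
  unfolding power_weight_def by measurable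

lemma weighted_mono: "A \<subseteq> B \<Longrightarrow> weighted w A \<le> weighted w B"
  unfolding weighted_def by (intro nn_integral_mono) (auto simp: indicator_def)

lemma emeasure_lborel_ball:
  fixes x :: "'a::euclidean_space"
  assumes "0 \<le> r"
  shows "emeasure lborel (ball x r)
    = ennreal (unit_ball_vol (real DIM('a)) * r powr real DIM('a))"
  using assms by (cases "r = 0") (simp_all add: emeasure_ball powr_realpow)

section \<open>Mass of balls under power weights\<close>

text \<open>A ball of radius \<open>r / 4\<close>, pushed outward from \<open>x\<close> by
  \<open>r / 2\<close>, stays inside \<open>ball x r\<close> and away from the origin, so the weight
  there is comparable to \<open>(norm x + r) powr \<alpha>\<close>. This works for every real
  \<open>\<alpha>\<close>, including the critical exponent \<open>-n\<close>.\<close>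

lemma weighted_ball_lower:
  fixes x :: "'a::euclidean_space"
  assumes "0 < r"
  shows "ennreal (unit_ball_vol (real DIM('a)) / 4 powr (real DIM('a) + \<bar>\<alpha>\<bar>)
      * (r powr real DIM('a) * (norm x + r) powr \<alpha>))
    \<le> weighted (power_weight \<alpha>) (ball x r)"
proof -
  \<comment> \<open>\<open>u\<close> is the direction of \<open>x\<close>, or any unit vector if
    \<open>x = 0\<close>; moving along it increases the norm by exactly the distance moved.\<close>
  obtain u :: 'a where u: "norm u = 1" "x = norm x *\<^sub>R u"
  proof (cases "x = 0")
    case True
    then show ?thesis
      using vector_choose_size[of 1] that by (metis norm_zero scaleR_zero_left zero_le_one)
  next
    case False
    then show ?thesis
      by (intro that[of "x /\<^sub>R norm x"]) auto
  qed
  define z where "z = x + (r / 2) *\<^sub>R u"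
  have "z = (norm x + r / 2) *\<^sub>R u"
    unfolding z_def by (metis u(2) scaleR_add_left)
  then have nz: "norm z = norm x + r / 2"
    using u assms by simp
  define m where "m = (norm x + r) powr \<alpha> / 4 powr \<bar>\<alpha>\<bar>"
  have sub: "ball z (r / 4) \<subseteq> ball x r"
  proof -
    have "dist z x = r / 2"
      using u assms by (simp add: z_def dist_norm)
    then show ?thesis
      using assms by (simp add: ball_subset_ball_iff)
  qed
  have m: "m \<le> power_weight \<alpha> y" if "y \<in> ball z (r / 4)" for y
  proof -
    have "\<bar>norm z - norm y\<bar> < r / 4"
      using that norm_triangle_ineq3[of z y] by (simp add: dist_norm)
    then have "(norm x + r) / 4 \<le> norm y" "norm y \<le> 4 * (norm x + r)"
      using nz assms norm_ge_zero[of x] by (simp_all add: field_simps, linarith+)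
    then show ?thesis
      using powr_comparable[of 4 "norm x + r" "norm y" \<alpha>] assms norm_ge_zero[of x]
      by (simp add: m_def power_weight_def add_nonneg_pos)
  qed
  have "ennreal (unit_ball_vol (real DIM('a)) / 4 powr (real DIM('a) + \<bar>\<alpha>\<bar>)
      * (r powr real DIM('a) * (norm x + r) powr \<alpha>))
    = ennreal (m * (unit_ball_vol (real DIM('a)) * (r / 4) powr real DIM('a)))"
    using assms by (simp add: m_def powr_add powr_divide field_simps)
  also have "\<dots> = ennreal m * emeasure lebesgue (ball z (r / 4))"
    using assms unit_ball_vol_pos[of "real DIM('a)"]
    by (simp add: emeasure_lborel_ball m_def flip: ennreal_mult)
  also have "\<dots> = (\<integral>\<^sup>+ y. ennreal m * indicator (ball z (r / 4)) y \<partial>lebesgue)"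
    by (rule nn_integral_cmult_indicator[symmetric]) simp
  also have "\<dots> \<le> weighted (power_weight \<alpha>) (ball z (r / 4))"
    unfolding weighted_def using m
    by (intro nn_integral_mono) (auto simp: indicator_def intro!: ennreal_leI)
  also have "\<dots> \<le> weighted (power_weight \<alpha>) (ball x r)"
    by (rule weighted_mono[OF sub])
  finally show ?thesis .
qed

lemma weighted_ball_origin_upper:
  fixes \<alpha> :: real
  assumes "- real DIM('a::euclidean_space) < \<alpha>"
  obtains C where "0 < C" and "\<And>R. 0 < R \<Longrightarrow>
    weighted (power_weight \<alpha>) (ball (0::'a) R) \<le> ennreal (C * R powr (real DIM('a) + \<alpha>))"
proof -
  let ?n = "real DIM('a)"
  let ?V = "unit_ball_vol ?n"
  \<comment> \<open>Halving the radius multiplies \<open>R powr (n + \<alpha>)\<close> by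
    \<open>q\<close>; the hypothesis \<open>- n < \<alpha>\<close> is what makes
    \<open>q < 1\<close>.\<close>
  define q where "q = (1/2) powr (?n + \<alpha>)"
  have q: "0 < q" "q < 1"
    using assms powr_less_mono'[of "1/2" 0 "?n + \<alpha>"] by (auto simp: q_def)
  define C where "C = 2 powr \<bar>\<alpha>\<bar> * ?V / (1 - q)"
  have "weighted (power_weight \<alpha>) (ball (0::'a) R) \<le> ennreal (C * R powr (?n + \<alpha>))"
    if R: "0 < R" for R
  proof -
    text \<open>The weight is dominated by a dyadic sum of multiples of indicators of balls, whose
      integrals form a geometric series of ratio \<open>q\<close>.\<close>
    define h where "h = (\<lambda>k::nat. 2 powr \<bar>\<alpha>\<bar> * (R * (1/2)^k) powr \<alpha>)"
    define B where "B = (\<lambda>k::nat. ball (0::'a) (R * (1/2)^k))"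
    have pt: "ennreal (power_weight \<alpha> y) * indicator (ball 0 R) y
        \<le> (\<Sum>k. ennreal (h k) * indicator (B k) y)" for y :: 'a
    proof (cases "y \<in> ball 0 R \<and> y \<noteq> 0")
      case True
      obtain j where j: "(1/2)^j < norm y / R"
        using real_arch_pow_inv[of "norm y / R" "1/2"] True R by auto
      \<comment> \<open>\<open>i\<close> is the first index whose dyadic radius is at most
        \<open>norm y\<close>. It is positive because \<open>norm y < R\<close>, so its predecessor
        \<open>k\<close> locates \<open>y\<close> in a shell where \<open>norm y\<close> is within a
        factor 2 of \<open>R * (1/2)^k\<close>.\<close>
      define i where "i = (LEAST i. R * (1/2)^i \<le> norm y)"
      have "R * (1/2)^j \<le> norm y"
        using j R by (simp add: field_simps)
      then have i: "R * (1/2)^i \<le> norm y"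
        unfolding i_def by (rule LeastI)
      have "i \<noteq> 0"
        using i True by (intro notI) auto
      then obtain k where k: "i = Suc k"
        using not0_implies_Suc by blast
      have "\<not> R * (1/2)^k \<le> norm y"
        using not_less_Least[of k "\<lambda>i. R * (1/2)^i \<le> norm y"] k by (simp add: i_def)
      then have yk: "norm y < R * (1/2)^k" by simp
      have "power_weight \<alpha> y \<le> h k"
        using powr_comparable[of 2 "R * (1/2)^k" "norm y" \<alpha>] yk i R norm_ge_zero[of y]
        by (simp add: k h_def power_weight_def field_simps)
      then have "ennreal (power_weight \<alpha> y) * indicator (ball 0 R) y
          \<le> ennreal (h k) * indicator (B k) y"
        using True yk by (simp add: B_def ennreal_leI)
      also have "\<dots> \<le> (\<Sum>k. ennreal (h k) * indicator (B k) y)"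
        using sum_le_suminf[of "\<lambda>k. ennreal (h k) * indicator (B k) y" "{k}"]
        by (simp del: mult_indicator_cong sum_mult_indicator)
      finally show ?thesis .
    \<comment> \<open>Off the ball the indicator vanishes, and at the origin the weight is 0 because
      \<open>0 powr \<alpha> = 0\<close>.\<close>
    qed (auto simp: power_weight_def)
    have "weighted (power_weight \<alpha>) (ball (0::'a) R)
        \<le> (\<integral>\<^sup>+ y. (\<Sum>k. ennreal (h k) * indicator (B k) y) \<partial>lebesgue)"
      unfolding weighted_def by (intro nn_integral_mono pt)
    also have "\<dots> = (\<Sum>k. \<integral>\<^sup>+ y. ennreal (h k) * indicator (B k) y \<partial>lebesgue)"
      by (intro nn_integral_suminf borel_measurable_times_ennreal borel_measurable_indicator)
        (auto simp: B_def)
    also have "\<dots> = (\<Sum>k. ennreal (h k) * emeasure lebesgue (B k))"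
      by (intro suminf_cong nn_integral_cmult_indicator) (simp add: B_def)
    also have "\<dots> = (\<Sum>k. ennreal (2 powr \<bar>\<alpha>\<bar> * ?V * R powr (?n + \<alpha>) * q^k))"
    proof (intro suminf_cong)
      fix k
      have "((1/2::real)^k) powr (?n + \<alpha>) = q^k"
        by (simp add: q_def powr_power powr_powr mult.commute flip: powr_realpow)
      then show "ennreal (h k) * emeasure lebesgue (B k)
          = ennreal (2 powr \<bar>\<alpha>\<bar> * ?V * R powr (?n + \<alpha>) * q^k)"
        using R by (simp add: h_def B_def emeasure_lborel_ball powr_mult powr_add mult_ac
            flip: ennreal_mult)
    qed
    also have "\<dots> = ennreal (2 powr \<bar>\<alpha>\<bar> * ?V * R powr (?n + \<alpha>) * (1 / (1 - q)))"
      using q by (intro suminf_ennreal_eq sums_mult geometric_sums) auto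
    finally show ?thesis
      by (simp add: C_def mult_ac)
  qed
  moreover have "0 < C"
    using q by (simp add: C_def unit_ball_vol_pos)
  ultimately show ?thesis
    using that by blast
qed

text \<open>If \<open>2 * r \<le> norm x\<close>, the weight is constant on the ball up to a factor.
  Otherwise the ball lies in \<open>ball 0 (3 * r)\<close>, whose mass is known, and
  \<open>r\<close> is comparable to \<open>norm x + r\<close>. The real-valued \<open>V\<close> lets
  later estimates be carried out in the reals.\<close>

lemma weighted_ball_comparable:
  fixes \<alpha> :: real
  assumes "- real DIM('a::euclidean_space) < \<alpha>"
  obtains K V where "1 \<le> K"
    and "\<And>x r. 0 < r \<Longrightarrow> weighted (power_weight \<alpha>) (ball (x::'a) r) = ennreal (V x r)"
    and "\<And>x r. 0 < r \<Longrightarrow> r powr real DIM('a) * (norm x + r) powr \<alpha> / K \<le> V x r"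
    and "\<And>x r. 0 < r \<Longrightarrow> V x r \<le> K * (r powr real DIM('a) * (norm x + r) powr \<alpha>)"
proof -
  let ?n = "real DIM('a)"
  let ?W = "\<lambda>(x::'a) r. weighted (power_weight \<alpha>) (ball x r)"
  let ?X = "\<lambda>(x::'a) r. r powr ?n * (norm x + r) powr \<alpha>"
  obtain C where C: "0 < C" "\<And>R. 0 < R \<Longrightarrow> ?W 0 R \<le> ennreal (C * R powr (?n + \<alpha>))"
    using weighted_ball_origin_upper[OF assms] by metis
  define k where "k = unit_ball_vol ?n / 4 powr (?n + \<bar>\<alpha>\<bar>)"
  define C1 where "C1 = 4 powr \<bar>\<alpha>\<bar> * unit_ball_vol ?n"
  define C2 where "C2 = C * 3 powr (?n + \<alpha>) * 3 powr \<bar>\<alpha>\<bar>"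
  define K where "K = 1 + 1 / k + C1 + C2"
  have k: "0 < k" and C12: "0 \<le> C1" "0 \<le> C2"
    using C by (simp_all add: k_def C1_def C2_def unit_ball_vol_pos)
  then have K: "1 \<le> K" "1 / k \<le> K" "C1 \<le> K" "C2 \<le> K"
    by (simp_all add: K_def)
  have upper: "?W x r \<le> ennreal (K * ?X x r)" if r: "0 < r" for x :: 'a and r
  proof (cases "2 * r \<le> norm x")
    case True
    define m where "m = 4 powr \<bar>\<alpha>\<bar> * (norm x + r) powr \<alpha>"
    have "power_weight \<alpha> y \<le> m" if "y \<in> ball x r" for y
    proof -
      have "norm x - norm y < r" "norm y - norm x < r"
        using that norm_triangle_ineq3[of x y] by (simp_all add: dist_norm abs_le_iff)
      then have "(norm x + r) / 4 \<le> norm y" "norm y \<le> 4 * (norm x + r)"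
        using True r by simp_all
      then show ?thesis
        using powr_comparable[of 4 "norm x + r" "norm y" \<alpha>] r norm_ge_zero[of x]
        by (simp add: m_def power_weight_def add_nonneg_pos)
    qed
    then have "?W x r \<le> (\<integral>\<^sup>+ y. ennreal m * indicator (ball x r) y \<partial>lebesgue)"
      unfolding weighted_def
      by (intro nn_integral_mono) (auto simp: indicator_def intro!: ennreal_leI)
    also have "\<dots> = ennreal m * emeasure lebesgue (ball x r)"
      by (rule nn_integral_cmult_indicator) simp
    also have "\<dots> = ennreal (C1 * ?X x r)"
      using r by (simp add: emeasure_lborel_ball m_def C1_def mult_ac flip: ennreal_mult)
    also have "\<dots> \<le> ennreal (K * ?X x r)"
      using K by (intro ennreal_leI mult_right_mono) auto
    finally show ?thesis .
  next
    case False
    have "ball x r \<subseteq> ball 0 (3 * r)"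
      using False by (simp add: ball_subset_ball_iff)
    then have "?W x r \<le> ?W 0 (3 * r)"
      by (rule weighted_mono)
    also have "\<dots> \<le> ennreal (C * (3 * r) powr (?n + \<alpha>))"
      using C r by simp
    also have "\<dots> = ennreal (C * 3 powr (?n + \<alpha>) * (r powr ?n * r powr \<alpha>))"
      using r by (simp add: powr_mult powr_add mult_ac)
    also have "\<dots> \<le> ennreal (C2 * ?X x r)"
    proof (intro ennreal_leI)
      have "(norm x + r) / 3 \<le> r" "r \<le> 3 * (norm x + r)"
        using False r norm_ge_zero[of x] by (simp_all, linarith+)
      then have "r powr \<alpha> \<le> 3 powr \<bar>\<alpha>\<bar> * (norm x + r) powr \<alpha>"
        using powr_comparable[of 3 "norm x + r" r \<alpha>] r norm_ge_zero[of x]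
        by (simp add: add_nonneg_pos)
      then show "C * 3 powr (?n + \<alpha>) * (r powr ?n * r powr \<alpha>) \<le> C2 * ?X x r"
        using C mult_left_mono[of "r powr \<alpha>" "3 powr \<bar>\<alpha>\<bar> * (norm x + r) powr \<alpha>"
            "C * 3 powr (?n + \<alpha>) * r powr ?n"]
        by (simp add: C2_def mult_ac)
    qed
    also have "\<dots> \<le> ennreal (K * ?X x r)"
      using K by (intro ennreal_leI mult_right_mono) auto
    finally show ?thesis .
  qed
  have lower: "ennreal (?X x r / K) \<le> ?W x r" if "0 < r" for x :: 'a and r
  proof -
    have "?X x r / K \<le> k * ?X x r"
      using K k mult_right_mono[of "1 / k" K "k * ?X x r"] by (simp add: field_simps)
    then show ?thesis
      using weighted_ball_lower[OF that, of \<alpha> x] order_trans ennreal_leI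
      unfolding k_def by blast
  qed
  \<comment> \<open>The upper bound makes every mass finite, so \<open>enn2real\<close> loses
    nothing.\<close>
  define V where "V = (\<lambda>x r. enn2real (?W x r))"
  have V: "?W x r = ennreal (V x r)" if "0 < r" for x :: 'a and r
    using le_less_trans[OF upper[OF that, of x] ennreal_less_top] by (simp add: V_def)
  show ?thesis
  proof (rule that[OF K(1)])
    fix x :: 'a and r :: real
    assume r: "0 < r"
    show "?W x r = ennreal (V x r)"
      by (rule V[OF r])
    show "?X x r / K \<le> V x r" "V x r \<le> K * ?X x r"
      using lower[OF r, of x] upper[OF r, of x] K unfolding V[OF r]
      by (simp_all add: V_def ennreal_le_iff)
  qed
qed

text \<open>\<open>D\<close> is the Morrey denominator. Raising the mass estimate to the power
  \<open>l\<^sub>2 / n\<close> turns \<open>r powr n\<close> into \<open>r powr l\<^sub>2\<close>,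
  which joins \<open>r powr l\<^sub>1\<close>. As \<open>l\<^sub>2\<close> may be negative, each
  bound on \<open>D\<close> may come from either bound on the mass.\<close>

lemma weighted_ball_powr_comparable:
  fixes \<beta> l\<^sub>1 l\<^sub>2 :: real
  assumes "- real DIM('a::euclidean_space) < \<beta>"
  obtains K D where "1 \<le> K"
    and "\<And>x r. 0 < r \<Longrightarrow> 0 < D x r"
    and "\<And>x r. 0 < r \<Longrightarrow> ennreal (r powr l\<^sub>1)
      * weighted (power_weight \<beta>) (ball (x::'a) r) ennpowr (l\<^sub>2 / real DIM('a)) = ennreal (D x r)"
    and "\<And>x r. 0 < r \<Longrightarrow>
      r powr (l\<^sub>1 + l\<^sub>2) * (norm x + r) powr (l\<^sub>2 * \<beta> / real DIM('a)) / K \<le> D x r"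
    and "\<And>x r. 0 < r \<Longrightarrow>
      D x r \<le> K * (r powr (l\<^sub>1 + l\<^sub>2) * (norm x + r) powr (l\<^sub>2 * \<beta> / real DIM('a)))"
proof -
  let ?n = "real DIM('a)"
  let ?X = "\<lambda>(x::'a) r. r powr ?n * (norm x + r) powr \<beta>"
  let ?Y = "\<lambda>(x::'a) r. r powr (l\<^sub>1 + l\<^sub>2) * (norm x + r) powr (l\<^sub>2 * \<beta> / ?n)"
  obtain K V where K: "1 \<le> K"
    and V: "\<And>x r. 0 < r \<Longrightarrow> weighted (power_weight \<beta>) (ball (x::'a) r) = ennreal (V x r)"
      "\<And>x r. 0 < r \<Longrightarrow> ?X x r / K \<le> V x r"
      "\<And>x r. 0 < r \<Longrightarrow> V x r \<le> K * ?X x r"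
    using weighted_ball_comparable[OF assms] by metis
  define L where "L = K powr \<bar>l\<^sub>2 / ?n\<bar>"
  define D where "D = (\<lambda>(x::'a) r. r powr l\<^sub>1 * V x r powr (l\<^sub>2 / ?n))"
  have X: "0 < ?X x r" if "0 < r" for x :: 'a and r
    using that norm_ge_zero[of x] by (smt (verit) mult_pos_pos powr_gt_zero)
  have Vpos: "0 < V x r" if "0 < r" for x :: 'a and r
    using V(2)[OF that, of x] X[OF that, of x] K
    by (smt (verit) divide_pos_pos)
  have Y: "r powr l\<^sub>1 * ?X x r powr (l\<^sub>2 / ?n) = ?Y x r" if "0 < r" for x :: 'a and r
    using that by (simp add: powr_mult powr_powr powr_add mult_ac)
  have D: "?Y x r / L \<le> D x r \<and> D x r \<le> L * ?Y x r" if r: "0 < r" for x :: 'a and r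
  proof -
    have *: "?X x r powr (l\<^sub>2 / ?n) / L \<le> V x r powr (l\<^sub>2 / ?n)"
      "V x r powr (l\<^sub>2 / ?n) \<le> L * ?X x r powr (l\<^sub>2 / ?n)"
      using powr_comparable[OF K X[OF r] V(2)[OF r] V(3)[OF r], of x "l\<^sub>2 / ?n"] unfolding L_def by auto
    show ?thesis
      unfolding Y[OF r, symmetric] D_def
      using mult_left_mono[OF *(1), of "r powr l\<^sub>1"] mult_left_mono[OF *(2), of "r powr l\<^sub>1"]
      by (simp add: mult_ac)
  qed
  show ?thesis
  proof (rule that[of L D])
    show "1 \<le> L"
      using K by (simp add: L_def ge_one_powr_ge_zero)
    fix x :: 'a and r :: real
    assume r: "0 < r"
    show "0 < D x r"
      using r Vpos[OF r, of x] by (simp add: D_def)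
    show "ennreal (r powr l\<^sub>1) * weighted (power_weight \<beta>) (ball x r) ennpowr (l\<^sub>2 / ?n)
        = ennreal (D x r)"
      using r Vpos[OF r, of x] by (simp add: V D_def ennreal_ennpowr ennreal_mult)
  qed (use D in auto)
qed

section \<open>Test functions and their Morrey norm\<close>

text \<open>The cutoff removes growth at infinity, so positive exponents \<open>s\<close> are
  available as well as the singular choice \<open>s = -n\<close>.\<close>

definition truncated_power :: "real \<Rightarrow> 'a::euclidean_space \<Rightarrow> real" where
  "truncated_power s y = indicator (ball 0 1) y * norm y powr s"

text \<open>Write \<open>\<rho> = norm x + r\<close>. For bounded \<open>\<rho>\<close> the quotient
  is controlled by \<open>(r / \<rho>) powr (n - \<sigma>) * \<rho> powr (n + \<alpha> -
  \<gamma>)\<close>, with both exponents nonnegative. For large \<open>\<rho>\<close> a ball meeting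
  the unit ball has \<open>r\<close> comparable to \<open>\<rho>\<close>, so the denominator is at
  least a constant times \<open>\<rho> powr \<gamma> \<ge> 1\<close>, while the numerator is at most
  the mass of the unit ball.\<close>

lemma truncated_power_in_morrey_space:
  fixes p \<beta> l\<^sub>1 l\<^sub>2 s :: real
  defines "n \<equiv> real DIM('a::euclidean_space)"
  defines "\<gamma> \<equiv> l\<^sub>1 + l\<^sub>2 + l\<^sub>2 * \<beta> / n"
  assumes "1 \<le> p" "- n < \<beta>" "0 < \<gamma>" "l\<^sub>1 + l\<^sub>2 \<le> n" "\<gamma> \<le> n + \<beta> + p * s"
  shows "(truncated_power s :: 'a \<Rightarrow> real) \<in> morrey_space p l\<^sub>1 l\<^sub>2 (power_weight \<beta>)"
proof -
  define \<alpha> where "\<alpha> = \<beta> + p * s"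
  define \<sigma> where "\<sigma> = l\<^sub>1 + l\<^sub>2"
  have \<alpha>: "- n < \<alpha>" "\<gamma> \<le> n + \<alpha>"
    using assms by (auto simp: \<alpha>_def)
  have \<delta>: "l\<^sub>2 * \<beta> / n = \<gamma> - \<sigma>"
    by (simp add: \<gamma>_def \<sigma>_def)
  obtain A V where A: "1 \<le> A"
    and V: "\<And>x r. 0 < r \<Longrightarrow> weighted (power_weight \<alpha>) (ball (x::'a) r) = ennreal (V x r)"
      "\<And>x r. 0 < r \<Longrightarrow> V x r \<le> A * (r powr n * (norm x + r) powr \<alpha>)"
    using weighted_ball_comparable[where 'a='a, folded n_def, OF \<alpha>(1)] by metis
  obtain K D where K: "1 \<le> K"
    and D: "\<And>x r. 0 < r \<Longrightarrow> 0 < D x r"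
      "\<And>x r. 0 < r \<Longrightarrow> ennreal (r powr l\<^sub>1)
        * weighted (power_weight \<beta>) (ball (x::'a) r) ennpowr (l\<^sub>2 / n) = ennreal (D x r)"
      "\<And>x r. 0 < r \<Longrightarrow> r powr \<sigma> * (norm x + r) powr (\<gamma> - \<sigma>) / K \<le> D x r"
    using weighted_ball_powr_comparable[where 'a='a, folded n_def, OF \<open>- n < \<beta>\<close>, of l\<^sub>1 l\<^sub>2]
    unfolding \<delta> \<sigma>_def[symmetric] by metis
  \<comment> \<open>The first summand serves the case \<open>\<rho> \<le> 4\<close>, the second the
    case \<open>\<rho> > 4\<close>.\<close>
  define B where "B = A * K * 4 powr (n + \<alpha> - \<gamma>) + A * K * 4 powr \<bar>\<sigma>\<bar>"
  have B: "A * K * 4 powr (n + \<alpha> - \<gamma>) \<le> B" "A * K * 4 powr \<bar>\<sigma>\<bar> \<le> B"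
    using A K by (simp_all add: B_def)
  then have "0 \<le> B"
    using A K by (smt (verit) mult_nonneg_nonneg powr_ge_zero)
  \<comment> \<open>The integrand is \<open>norm y powr \<alpha>\<close> on the unit ball; at the
    origin both sides are 0 by the convention for \<open>powr\<close>.\<close>
  have num: "(\<integral>\<^sup>+ y \<in> ball x r. ennreal (\<bar>truncated_power s y\<bar> powr p * power_weight \<beta> y) \<partial>lebesgue)
      = weighted (power_weight \<alpha>) (ball (x::'a) r \<inter> ball 0 1)" for x r
    unfolding weighted_def
    by (intro nn_integral_cong)
      (auto simp: truncated_power_def power_weight_def \<alpha>_def indicator_def powr_powr powr_add mult_ac)
  have bound: "weighted (power_weight \<alpha>) (ball (x::'a) r \<inter> ball 0 1) \<le> ennreal (B * D x r)"
    if r: "0 < r" for x r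
  proof -
    define \<rho> where "\<rho> = norm x + r"
    have \<rho>: "0 < \<rho>" "r \<le> \<rho>"
      using r by (auto simp: \<rho>_def add_nonneg_pos)
    have DK: "r powr \<sigma> * \<rho> powr (\<gamma> - \<sigma>) \<le> K * D x r"
      using D(3)[OF r, of x] K by (simp add: \<rho>_def field_simps)
    consider "\<rho> \<le> 4" | "4 < \<rho>" "ball x r \<inter> ball 0 1 = {}" | "4 < \<rho>" "ball x r \<inter> ball 0 1 \<noteq> {}"
      by linarith
    then show ?thesis
    proof cases
      case 1
      \<comment> \<open>Replacing \<open>r powr (n - \<sigma>)\<close> by
        \<open>\<rho> powr (n - \<sigma>)\<close> is where
        \<open>l\<^sub>1 + l\<^sub>2 \<le> n\<close> enters.\<close>
      have "r powr n * \<rho> powr \<alpha> = r powr \<sigma> * r powr (n - \<sigma>) * \<rho> powr \<alpha>"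
        by (simp flip: powr_add)
      also have "\<dots> \<le> r powr \<sigma> * \<rho> powr (n - \<sigma>) * \<rho> powr \<alpha>"
        using r \<rho> assms by (intro mult_right_mono mult_left_mono powr_mono2) (auto simp: \<sigma>_def)
      also have "\<dots> = r powr \<sigma> * \<rho> powr (\<gamma> - \<sigma>) * \<rho> powr (n + \<alpha> - \<gamma>)"
        by (simp add: mult.assoc algebra_simps flip: powr_add)
      also have "\<dots> \<le> (K * D x r) * 4 powr (n + \<alpha> - \<gamma>)"
        using 1 \<rho> \<alpha> K D(1)[OF r, of x] by (intro mult_mono[OF DK] powr_mono2) auto
      finally have "V x r \<le> A * ((K * D x r) * 4 powr (n + \<alpha> - \<gamma>))"
        using V(2)[OF r, of x] A unfolding \<rho>_def
        by (meson order_trans mult_left_mono zero_le_one)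
      also have "\<dots> \<le> B * D x r"
        using mult_right_mono[OF B(1), of "D x r"] D(1)[OF r, of x] by (simp add: mult_ac)
      finally have "weighted (power_weight \<alpha>) (ball x r) \<le> ennreal (B * D x r)"
        by (simp add: V(1)[OF r] ennreal_leI)
      then show ?thesis
        using weighted_mono[of "ball x r \<inter> ball 0 1" "ball x r"] order_trans by blast
    next
      case 2
      then show ?thesis
        by (simp add: weighted_def)
    next
      case 3
      \<comment> \<open>A common point gives \<open>\<rho> < 2 * r + 1\<close>; together with
        \<open>\<rho> > 4\<close> this forces \<open>r > 3/2\<close> and hence
        \<open>\<rho> < 4 * r\<close>.\<close>
      then obtain z where "dist x z < r" "norm z < 1"
        by auto
      then have "norm x < r + 1"
        by (smt (verit) dist_norm norm_triangle_sub)
      then have "\<rho> / 4 \<le> r" "r \<le> 4 * \<rho>"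
        using 3 \<rho> by (auto simp: \<rho>_def)
      then have "\<rho> powr \<sigma> / 4 powr \<bar>\<sigma>\<bar> \<le> r powr \<sigma>"
        using powr_comparable[of 4 \<rho> r \<sigma>] \<rho> by auto
      then have "\<rho> powr \<sigma> * \<rho> powr (\<gamma> - \<sigma>) \<le> 4 powr \<bar>\<sigma>\<bar> * r powr \<sigma> * \<rho> powr (\<gamma> - \<sigma>)"
        by (intro mult_right_mono) (auto simp: field_simps)
      also have "\<dots> \<le> 4 powr \<bar>\<sigma>\<bar> * (K * D x r)"
        using DK by (simp add: mult.assoc)
      finally have "\<rho> powr \<gamma> \<le> 4 powr \<bar>\<sigma>\<bar> * (K * D x r)"
        by (simp flip: powr_add)
      moreover have "1 \<le> \<rho> powr \<gamma>"
        using 3 assms by (intro ge_one_powr_ge_zero) auto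
      ultimately have "A * 1 \<le> A * (4 powr \<bar>\<sigma>\<bar> * (K * D x r))"
        using A by (intro mult_left_mono) auto
      also have "\<dots> \<le> B * D x r"
        using mult_right_mono[OF B(2), of "D x r"] D(1)[OF r, of x] by (simp add: mult_ac)
      finally have "V 0 1 \<le> B * D x r"
        using V(2)[of 1 0] by simp
      then have "weighted (power_weight \<alpha>) (ball (0::'a) 1) \<le> ennreal (B * D x r)"
        by (simp add: V(1) ennreal_leI)
      then show ?thesis
        using weighted_mono[of "ball x r \<inter> ball 0 1" "ball 0 1"] order_trans by blast
    qed
  qed
  have "morrey_norm p l\<^sub>1 l\<^sub>2 (power_weight \<beta>) (truncated_power s :: 'a \<Rightarrow> real)
      \<le> ennreal (B powr (1 / p))"
    unfolding morrey_norm_def num n_def[symmetric]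
  proof (intro SUP_least ennpowr_le)
    fix x :: 'a and r :: real
    assume "r \<in> {0<..}"
    then have r: "0 < r" by simp
    show "weighted (power_weight \<alpha>) (ball x r \<inter> ball 0 1) / (ennreal (r powr l\<^sub>1) *
        weighted (power_weight \<beta>) (ball x r) ennpowr (l\<^sub>2 / n)) \<le> ennreal B"
      unfolding D(2)[OF r]
      using divide_right_mono_ennreal[OF bound[OF r], of x "ennreal (D x r)"] D(1)[OF r, of x] \<open>0 \<le> B\<close>
      by (simp add: divide_ennreal)
  qed (use \<open>0 \<le> B\<close> assms in auto)
  then have "morrey_norm p l\<^sub>1 l\<^sub>2 (power_weight \<beta>) (truncated_power s :: 'a \<Rightarrow> real) < \<infinity>"
    using le_less_trans by fastforce
  moreover have "(truncated_power s :: 'a \<Rightarrow> real) \<in> borel_measurable borel"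
    unfolding truncated_power_def power_weight_def[symmetric]
    by (intro borel_measurable_times borel_measurable_indicator borel_measurable_power_weight) simp
  then have "(truncated_power s :: 'a \<Rightarrow> real) \<in> borel_measurable lebesgue"
    by (intro measurable_completion) simp
  ultimately show ?thesis
    by (simp add: morrey_space_def)
qed

section \<open>Lower bound for the weak Morrey norm\<close>

text \<open>Only the term of the supremum with centre 0, radius \<open>r\<close> and level
  \<open>t\<close> is kept. Its level set is the whole ball, of mass about
  \<open>r powr (n + \<beta>)\<close>, and its denominator is about
  \<open>r powr \<gamma>\<close>.\<close>

lemma weak_morrey_norm_lower:
  fixes p \<beta> l\<^sub>1 l\<^sub>2 :: real
  defines "n \<equiv> real DIM('a::euclidean_space)"
  defines "\<gamma> \<equiv> l\<^sub>1 + l\<^sub>2 + l\<^sub>2 * \<beta> / n"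
  assumes "0 < p" "- n < \<beta>"
  obtains \<kappa> where "0 < \<kappa>"
    and "\<And>(g :: 'a \<Rightarrow> ennreal) t r. \<lbrakk>0 < t; 0 < r; \<And>y. y \<in> ball 0 r \<Longrightarrow> ennreal t < g y\<rbrakk> \<Longrightarrow>
      ennreal (t * (\<kappa> * r powr (n + \<beta> - \<gamma>)) powr (1 / p))
        \<le> weak_morrey_norm p l\<^sub>1 l\<^sub>2 (power_weight \<beta>) g"
proof -
  let ?w = "power_weight \<beta> :: 'a \<Rightarrow> real"
  have n: "0 < n"
    by (simp add: n_def)
  obtain A V where A: "1 \<le> A"
    and V: "\<And>x r. 0 < r \<Longrightarrow> weighted (power_weight \<beta>) (ball (x::'a) r) = ennreal (V x r)"
      "\<And>x r. 0 < r \<Longrightarrow> r powr n * (norm x + r) powr \<beta> / A \<le> V x r"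
    using weighted_ball_comparable[where 'a='a, folded n_def, OF \<open>- n < \<beta>\<close>] by metis
  obtain K D where K: "1 \<le> K"
    and D: "\<And>x r. 0 < r \<Longrightarrow> 0 < D x r"
      "\<And>x r. 0 < r \<Longrightarrow> ennreal (r powr l\<^sub>1)
        * weighted (power_weight \<beta>) (ball (x::'a) r) ennpowr (l\<^sub>2 / n) = ennreal (D x r)"
      "\<And>x r. 0 < r \<Longrightarrow> D x r \<le> K * (r powr (l\<^sub>1 + l\<^sub>2) * (norm x + r) powr (l\<^sub>2 * \<beta> / n))"
    using weighted_ball_powr_comparable[where 'a='a, folded n_def, OF \<open>- n < \<beta>\<close>, of l\<^sub>1 l\<^sub>2]
    by metis
  \<comment> \<open>The weak norm uses \<open>|B(x,r)|\<close> to the power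
    \<open>l\<^sub>1 / n\<close> where the strong norm uses \<open>r powr l\<^sub>1\<close>;
    \<open>U\<close> is the ratio of the two.\<close>
  define U where "U = unit_ball_vol n powr (l\<^sub>1 / n)"
  have vol: "unit_ball_vol n \<noteq> 0"
    using n by (intro less_imp_neq[THEN not_sym] unit_ball_vol_pos) simp
  then have U: "0 < U"
    by (simp add: U_def)
  define \<kappa> where "\<kappa> = 1 / (A * U * K)"
  have \<kappa>: "0 < \<kappa>"
    using A K U by (simp add: \<kappa>_def)
  have "ennreal (t * (\<kappa> * r powr (n + \<beta> - \<gamma>)) powr (1 / p)) \<le> weak_morrey_norm p l\<^sub>1 l\<^sub>2 ?w g"
    if t: "0 < t" and r: "0 < r" and g: "\<And>y. y \<in> ball 0 r \<Longrightarrow> ennreal t < g y"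
    for g :: "'a \<Rightarrow> ennreal" and t r
  proof -
    let ?q = "t powr p * V 0 r / (U * D 0 r)"
    have V0: "r powr (n + \<beta>) / A \<le> V 0 r" and D0: "D 0 r \<le> K * r powr \<gamma>" "0 < D 0 r"
      using V(2)[OF r, of 0] D(3)[OF r, of 0] D(1)[OF r, of 0] by (simp_all add: powr_add \<gamma>_def)
    have Vpos: "0 < V 0 r"
      using V0 A r by (smt (verit) divide_pos_pos powr_gt_zero)
    have "\<kappa> * r powr (n + \<beta> - \<gamma>) = (r powr (n + \<beta>) / A) / (U * (K * r powr \<gamma>))"
      using A U K r by (simp add: \<kappa>_def powr_diff field_simps)
    also have "\<dots> \<le> V 0 r / (U * D 0 r)"
      using V0 D0 U Vpos by (intro frac_le mult_left_mono mult_pos_pos) auto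
    finally have "t powr p * (\<kappa> * r powr (n + \<beta> - \<gamma>)) \<le> ?q"
      using mult_left_mono[of _ _ "t powr p"] by fastforce
    then have "(t powr p * (\<kappa> * r powr (n + \<beta> - \<gamma>))) powr (1 / p) \<le> ?q powr (1 / p)"
      using \<kappa> \<open>0 < p\<close> by (intro powr_mono2) auto
    then have "t * (\<kappa> * r powr (n + \<beta> - \<gamma>)) powr (1 / p) \<le> ?q powr (1 / p)"
      using t \<kappa> \<open>0 < p\<close> by (simp add: powr_mult powr_powr)
    then have "ennreal (t * (\<kappa> * r powr (n + \<beta> - \<gamma>)) powr (1 / p)) \<le> ennreal ?q ennpowr (1 / p)"
      using t U D0 Vpos by (subst ennreal_ennpowr) (auto intro!: ennreal_leI)
    also have "ennreal ?q = (ennreal (t powr p) * weighted ?w {y \<in> ball 0 r. g y > ennreal t})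
        / (emeasure lebesgue (ball (0::'a) r) ennpowr (l\<^sub>1 / n)
          * weighted ?w (ball 0 r) ennpowr (l\<^sub>2 / n))"
    proof -
      have "{y \<in> ball 0 r. g y > ennreal t} = ball 0 r"
        using g by auto
      moreover have "emeasure lebesgue (ball (0::'a) r) ennpowr (l\<^sub>1 / n)
          = ennreal U * ennreal (r powr l\<^sub>1)"
        using r n vol unit_ball_vol_pos[of n]
        by (simp add: emeasure_lborel_ball ennreal_ennpowr U_def powr_mult powr_powr
            flip: n_def ennreal_mult)
      then have "emeasure lebesgue (ball (0::'a) r) ennpowr (l\<^sub>1 / n)
          * weighted ?w (ball 0 r) ennpowr (l\<^sub>2 / n) = ennreal (U * D 0 r)"
        using U D0 D(2)[OF r, of 0] by (simp add: mult.assoc ennreal_mult)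
      ultimately show ?thesis
        using t U D0 Vpos by (simp only: V(1)[OF r]) (simp add: divide_ennreal flip: ennreal_mult)
    qed
    also have "\<dots> ennpowr (1 / p) \<le> weak_morrey_norm p l\<^sub>1 l\<^sub>2 ?w g"
      unfolding weak_morrey_norm_def n_def
      by (intro SUP_upper2[of 0] SUP_upper2[of r] SUP_upper2[of t]) (use r t in auto)
    finally show ?thesis .
  qed
  with \<kappa> that show ?thesis
    by blast
qed

section \<open>Critical divergence and averages of the test functions\<close>

text \<open>By scale invariance the weight gives all balls centred at the origin a mass bounded below, so
  finiteness would contradict continuity from above along balls shrinking to a null set.\<close>

lemma weighted_ball_critical:
  "weighted (power_weight (- real DIM('a))) (ball (0::'a::euclidean_space) 1) = \<infinity>"
proof (rule ccontr)
  let ?n = "real DIM('a)"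
  let ?w = "power_weight (- ?n) :: 'a \<Rightarrow> real"
  assume fin: "weighted ?w (ball (0::'a) 1) \<noteq> \<infinity>"
  define M where "M = density lebesgue (\<lambda>y. ennreal (?w y))"
  have "?w \<in> borel_measurable lebesgue"
    by (intro measurable_completion) simp
  then have M: "emeasure M E = weighted ?w E" if "E \<in> sets lebesgue" for E
    using that by (simp add: M_def weighted_def emeasure_density)
  define E where "E = (\<lambda>k. ball (0::'a) (1 / real (Suc k)))"
  have "decseq E"
    unfolding E_def by (intro decseq_SucI subset_ball divide_left_mono) auto
  moreover have "emeasure M (E k) \<noteq> \<infinity>" for k
  proof -
    have "E k \<subseteq> ball 0 1"
      unfolding E_def by (rule subset_ball) simp
    then show ?thesis
      using weighted_mono[of "E k" "ball 0 1" ?w] fin by (auto simp: M E_def top_unique)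
  qed
  ultimately have lim: "(\<lambda>k. emeasure M (E k)) \<longlonglongrightarrow> emeasure M (\<Inter>k. E k)"
    by (intro Lim_emeasure_decseq) (auto simp: E_def M_def)
  have "(\<Inter>k. E k) = {0}"
  proof
    show "(\<Inter>k. E k) \<subseteq> {0}"
    proof
      fix y assume y: "y \<in> (\<Inter>k. E k)"
      show "y \<in> {0}"
      proof (rule ccontr)
        assume "y \<notin> {0}"
        then obtain k where "inverse (real (Suc k)) < norm y"
          using reals_Archimedean[of "norm y"] by auto
        moreover have "y \<in> E k"
          using y by blast
        ultimately show False
          by (simp add: E_def inverse_eq_divide)
      qed
    qed
  qed (auto simp: E_def)
  moreover have "weighted ?w {0} = 0"
    unfolding weighted_def power_weight_def
    by (subst nn_integral_cong[where v = "\<lambda>_. 0"]) (auto simp: indicator_def)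
  ultimately have "(\<lambda>k. emeasure M (E k)) \<longlonglongrightarrow> 0"
    using lim by (simp add: M)
  \<comment> \<open>At the exponent \<open>-n\<close> and centre 0 the powers of the radius cancel,
    which leaves a bound free of \<open>k\<close>.\<close>
  moreover have "ennreal (unit_ball_vol ?n / 4 powr (?n + ?n)) \<le> emeasure M (E k)" for k
    using weighted_ball_lower[of "1 / real (Suc k)" "- ?n" "0::'a"]
    by (simp add: M E_def flip: powr_add)
  ultimately have "ennreal (unit_ball_vol ?n / 4 powr (?n + ?n)) \<le> 0"
    by (intro LIMSEQ_le_const) auto
  then show False
    using unit_ball_vol_pos[of ?n] by simp
qed

text \<open>The unit ball is itself admissible in the supremum at each of its points, so one average
  bounds the maximal function from below uniformly there.\<close>

lemma maximal_truncated_power_ge: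
  fixes x :: "'a::euclidean_space"
  assumes "x \<in> ball 0 1"
  shows "weighted (power_weight s) (ball (0::'a) 1) / emeasure lebesgue (ball (0::'a) 1)
    \<le> maximal (truncated_power s) x"
proof -
  have "weighted (power_weight s) (ball (0::'a) 1)
      = (\<integral>\<^sup>+ y \<in> ball 0 1. ennreal \<bar>truncated_power s (y::'a)\<bar> \<partial>lebesgue)"
    unfolding weighted_def
    by (intro nn_integral_cong) (auto simp: truncated_power_def power_weight_def indicator_def)
  then show ?thesis
    unfolding maximal_def using assms by (intro SUP_upper2[of "(0, 1)"]) auto
qed

section \<open>Deriving the two inequalities\<close>

theorem proposition3p2:
  fixes p \<beta> l\<^sub>1 l\<^sub>2 n :: real
  defines "n \<equiv> real DIM('a::euclidean_space)"
  assumes "1 \<le> p"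
    and "\<beta> > - n"
    and "- l\<^sub>2 * \<beta> / n < l\<^sub>1 + l\<^sub>2"
    and "l\<^sub>1 + l\<^sub>2 \<le> n"
    and "maximal_bounded_weak p l\<^sub>1 l\<^sub>2 (power_weight \<beta> :: 'a \<Rightarrow> real)"
  shows "l\<^sub>1 + l\<^sub>2 - n \<le> \<beta> * (1 - l\<^sub>2 / n) \<and>
         \<beta> * (1 - l\<^sub>2 / n) < l\<^sub>1 + l\<^sub>2 + n * (p - 1)"
proof -
  let ?w = "power_weight \<beta> :: 'a \<Rightarrow> real"
  define \<gamma> where "\<gamma> = l\<^sub>1 + l\<^sub>2 + l\<^sub>2 * \<beta> / n"
  define avg where
    "avg = (\<lambda>s. weighted (power_weight s) (ball (0::'a) 1) / emeasure lebesgue (ball (0::'a) 1))"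
  have \<gamma>: "0 < \<gamma>"
    using assms by (simp add: \<gamma>_def)
  obtain \<kappa> where \<kappa>: "0 < \<kappa>"
    and weak: "\<And>(g :: 'a \<Rightarrow> ennreal) t r. \<lbrakk>0 < t; 0 < r; \<And>y. y \<in> ball 0 r \<Longrightarrow> ennreal t < g y\<rbrakk> \<Longrightarrow>
      ennreal (t * (\<kappa> * r powr (n + \<beta> - \<gamma>)) powr (1 / p)) \<le> weak_morrey_norm p l\<^sub>1 l\<^sub>2 ?w g"
    using weak_morrey_norm_lower[where 'a='a and p=p and \<beta>=\<beta> and l\<^sub>1=l\<^sub>1 and l\<^sub>2=l\<^sub>2]
      \<open>1 \<le> p\<close> \<open>\<beta> > - n\<close> unfolding \<gamma>_def n_def by (metis less_le_trans zero_less_one)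
  \<comment> \<open>\<open>C\<close> is the finite weak norm of the maximal function of the test
    function. It depends on \<open>s\<close> but not on \<open>t\<close> or \<open>r\<close>, so
    each contradiction comes from making the left side unbounded.\<close>
  have bounded: "\<exists>C. \<forall>t r. 0 < t \<longrightarrow> ennreal t < avg s \<longrightarrow> 0 < r \<longrightarrow> r \<le> 1 \<longrightarrow>
      t * (\<kappa> * r powr (n + \<beta> - \<gamma>)) powr (1 / p) \<le> C"
    if s: "\<gamma> \<le> n + \<beta> + p * s" for s
  proof -
    let ?N = "weak_morrey_norm p l\<^sub>1 l\<^sub>2 ?w (maximal (truncated_power s))"
    have "(truncated_power s :: 'a \<Rightarrow> real) \<in> morrey_space p l\<^sub>1 l\<^sub>2 ?w"
      using truncated_power_in_morrey_space[where 'a='a, of p \<beta> l\<^sub>1 l\<^sub>2 s] assms \<gamma> s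
      by (simp add: \<gamma>_def n_def)
    then have "?N < \<infinity>"
      using assms by (auto simp: maximal_bounded_weak_def weak_morrey_space_def)
    then obtain C where C: "?N = ennreal C" "0 \<le> C"
      by (cases ?N) auto
    have "t * (\<kappa> * r powr (n + \<beta> - \<gamma>)) powr (1 / p) \<le> C"
      if "0 < t" "ennreal t < avg s" "0 < r" "r \<le> 1" for t r
    proof -
      have large: "ennreal t < maximal (truncated_power s) y" if "y \<in> ball (0::'a) r" for y
        using maximal_truncated_power_ge[of y s] that \<open>r \<le> 1\<close> \<open>ennreal t < avg s\<close>
        by (auto simp: avg_def)
      show ?thesis
        using weak[of t r "maximal (truncated_power s)"] large that C by (simp add: ennreal_le_iff)
    qed
    then show ?thesis
      by blast
  qed
  have "\<gamma> - n \<le> \<beta>"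
  proof (rule ccontr)
    assume "\<not> \<gamma> - n \<le> \<beta>"
    \<comment> \<open>With \<open>s = e / p\<close> the condition
      \<open>\<gamma> \<le> n + \<beta> + p * s\<close> holds with equality, and the exponent of
      \<open>r\<close> in the lower bound is \<open>-e < 0\<close>.\<close>
    define e where "e = \<gamma> - n - \<beta>"
    then have e: "0 < e"
      using \<open>\<not> \<gamma> - n \<le> \<beta>\<close> by simp
    have "weighted (power_weight (e / p)) (ball (0::'a) 1) \<noteq> 0"
      using weighted_ball_lower[of 1 "e / p" "0::'a"] unit_ball_vol_pos[of "real DIM('a)"]
      by (intro notI) simp
    then have "avg (e / p) \<noteq> 0"
      by (simp add: avg_def ennreal_divide_eq_0_iff emeasure_lborel_ball)
    then obtain t where t: "0 < t" "ennreal t < avg (e / p)"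
      by (metis ennreal_less_zero_iff gr_zeroI ennreal_rat_dense)
    obtain C where C: "\<And>r. 0 < r \<Longrightarrow> r \<le> 1 \<Longrightarrow> t * (\<kappa> * r powr (- e)) powr (1 / p) \<le> C"
    proof -
      have "n + \<beta> - \<gamma> = - e" "\<gamma> \<le> n + \<beta> + p * (e / p)"
        using \<open>1 \<le> p\<close> by (simp_all add: e_def)
      with bounded[of "e / p"] t that show thesis
        by auto
    qed
    \<comment> \<open>For the radius \<open>r = v powr (- 1 / e) \<le> 1\<close> one has
      \<open>r powr (- e) = v\<close>; the size of \<open>v\<close> then makes the left side of
      \<open>C\<close> at least \<open>\<bar>C\<bar> + 1\<close>.\<close>
    define v where "v = max 1 (((\<bar>C\<bar> + 1) / t) powr p / \<kappa>)"
    have v: "1 \<le> v" "((\<bar>C\<bar> + 1) / t) powr p \<le> \<kappa> * v"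
      using \<kappa> by (auto simp: v_def max_def field_simps)
    have "(v powr (- 1 / e)) powr (- e) = v"
      using v e by (simp add: powr_powr)
    moreover have "v powr (- 1 / e) \<le> 1"
      using v e powr_mono[of "- 1 / e" 0 v] by simp
    ultimately have "t * (\<kappa> * v) powr (1 / p) \<le> C"
      using C[of "v powr (- 1 / e)"] v by simp
    moreover have "(\<bar>C\<bar> + 1) / t \<le> (\<kappa> * v) powr (1 / p)"
      using powr_mono2[OF _ _ v(2), of "1 / p"] t assms by (simp add: powr_powr)
    ultimately show False
      using t by (simp add: field_simps)
  qed
  moreover have "\<beta> < \<gamma> + n * (p - 1)"
  proof (rule ccontr)
    assume "\<not> \<beta> < \<gamma> + n * (p - 1)"
    \<comment> \<open>The negated bound is precisely admissibility of \<open>s = -n\<close>.\<close>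
    then have "\<gamma> \<le> n + \<beta> + p * (- n)"
      by (simp add: algebra_simps)
    moreover have "avg (- n) = \<infinity>"
      by (simp add: avg_def n_def weighted_ball_critical emeasure_lborel_ball ennreal_top_divide)
    ultimately obtain C where "\<forall>t r. 0 < t \<longrightarrow> 0 < r \<longrightarrow> r \<le> 1 \<longrightarrow>
        t * (\<kappa> * r powr (n + \<beta> - \<gamma>)) powr (1 / p) \<le> C"
      using bounded[of "- n"] by (auto simp: less_top)
    \<comment> \<open>The radius is fixed at 1; as the average is infinite, \<open>t\<close> ranges
      over all positive reals.\<close>
    from this[rule_format, of _ 1] have C: "t * \<kappa> powr (1 / p) \<le> C" if "0 < t" for t
      using that by simp
    define a where "a = \<kappa> powr (1 / p)"
    have "0 < a"
      using \<kappa> by (simp add: a_def)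
    then show False
      using C[of "(\<bar>C\<bar> + 1) / a"] by (simp flip: a_def)
  qed
  \<comment> \<open>Since \<open>\<beta> * (1 - l\<^sub>2 / n) = \<beta> - \<gamma> + l\<^sub>1 +
    l\<^sub>2\<close>, the two bounds on \<open>\<beta>\<close> are the claimed ones.\<close>
  ultimately show ?thesis
    by (simp add: \<gamma>_def algebra_simps)
qed

end
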